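(* Let $L=2U\oplus L_0$ be an even integral lattice of signature $(2,n)$ containing two hyperbolic planes, and let $\psi$ be a (not identically zero) modular form with character $\det$ or with trivial character for an arithmetic subgroup $\Gamma$ of $\widetilde{\mathrm O}^+(L)$. Then the order of vanishing of $\psi$ along any boundary component $F$ of $\mathcal D_L$ is an integer.
   Context: Lattices: an even integral lattice is a free $\mathbb Z$-module of finite rank with a non-degenerate symmetric bilinear form $(\cdot,\cdot)$ with values in $\mathbb Z$ and $(u,u)\in2\mathbb Z$. Signature $(2,n)$ means two positive and $n$ negative squares. $U=\mathbb Z e\oplus\mathbb Z f$ with $(e,e)=(f,f)=0$, $(e,f)=1$. With $L^\vee$ the dual lattice and $D(L)=L^\vee/L$ carrying its $\mathbb Q/2\mathbb Z$-valued quadratic form, $\widetilde{\mathrm O}(L)=\ker(\mathrm O(L)\to\mathrm O(D(L)))$. The real spinor norm of a product of reflections $\sigma_{v_1}\cdots\sigma_{v_m}\in \mathrm O(L\otimes\mathbb R)$, $\sigma_v(x)=x-\frac{2(x,v)}{(v,v)}v$, is $\prod_i(-\frac{(v_i,v_i)}{2})(\mathbb R^\times)^2$; $\mathrm O^+(\cdot)$ denotes the subgroup of trivial real spinor norm, and $\widetilde{\mathrm O}^+(L)=\widetilde{\mathrm O}(L)\cap\mathrm O^+(L)$. An arithmetic subgroup of it is a subgroup of finite index. Domain: $\mathcal D_L$ is a connected component of $\{[Z]\in\mathbb P(L\otimes\mathbb C)\mid (Z,Z)=0,\ (Z,\bar Z)>0\}$ and $\mathcal D_L^\bullet\subset L\otimes\mathbb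 C$ is the affine cone over it. Rational boundary components (cusps) $F$ of $\mathcal D_L$ correspond to non-zero totally isotropic subspaces $E\subset L\otimes\mathbb Q$; $F$ has dimension $\dim E-1\in\{0,1\}$. $U(F)$ is the centre of the unipotent radical of the stabiliser of $E\otimes\mathbb R$ in $\mathrm O^+(L\otimes\mathbb R)$, a real vector group, and $U(F)_{\mathbb Z}=U(F)\cap\Gamma$, a lattice in it. Order of vanishing (toroidal): for $r\in U(F)_{\mathbb Z}$ write $r=\exp(N)$ with $N$ nilpotent. Toroidal boundary divisors over $F$ correspond to elements $r\neq 1$, primitive in $U(F)_{\mathbb Z}$, such that $\exp(zN)$ maps $\mathcal D_L^\bullet$ into itself whenever $\operatorname{Im}z\ge0$ (if $\dim F=1$, this is the unique suitably oriented generator of $U(F)_{\mathbb Z}\cong\mathbb Z$; if $\dim F=0$, it ranges over primitive vectors in the closed rational cone of $U(F)$). A modular form of weight $k\in\mathbb Z$ and character $\chi\colon\Gamma\to\mathbb C^\times$ (of finite order) is a holomorphic function $\psi$ on $\mathcal D_L^\bullet$ with $\psi(sZ)=s^{-k}\psi(Z)$ for $s\in\mathbb C^\times$, $\psi(gZ)=\chi(g)\psi(Z)$ for $g\in\Gamma$, and holomorphic at the cusps. Given such $r$, let $a\in\mathbb Q$ with $\chi(r)=e^{2\pi i a}$; then there is an expansion $\psi(\exp(zN)Z)=\sum_{m\in a+\mathbb Z}c_m(Z)e^{2\pi i m z}$ for $\operatorname{Im} z\ge 0$, $Z\in\mathcal D_L^\bullet$. Holomorphic at the cusps means $c_m\equiv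 0$ for $m<0$, for all $F$ and $r$. The order of vanishing of $\psi$ along the boundary divisor given by $r$ is the smallest $m$ with $c_m\not\equiv0$. The order of vanishing of $\psi$ along $F$ is its order along the boundary divisor(s) over $F$; to say that it is an integer means that this holds for every such $r$. *)

theory Defs
  imports "HOL-Analysis.Analysis" "HOL-Algebra.Coset"
begin

section \<open>Lattices\<close>

text \<open>
  A lattice of rank \<open>CARD('n)\<close> is given, after the choice of a \<open>\<int>\<close>-basis, by its Gram
  matrix \<open>G :: int^'n^'n\<close>.  Then \<open>L\<close>, \<open>L \<otimes> \<rat>\<close>, \<open>L \<otimes> \<real>\<close>, \<open>L \<otimes> \<complex>\<close> are the types
  \<open>int^'n\<close>, \<open>rat^'n\<close>, \<open>real^'n\<close>, \<open>complex^'n\<close>, and \<open>bform G\<close> is the form on each of them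
  (bilinear, not Hermitian, over \<open>\<complex>\<close>).
\<close>

definition bform :: "int^'n^'n \<Rightarrow> 'a::comm_ring_1^'n \<Rightarrow> 'a^'n \<Rightarrow> 'a" where
  "bform G x y = (\<Sum>i\<in>UNIV. \<Sum>j\<in>UNIV. of_int (G $ i $ j) * x $ i * y $ j)"

definition map_vec :: "('a \<Rightarrow> 'b) \<Rightarrow> 'a^'n \<Rightarrow> 'b^'n" where
  "map_vec f x = (\<chi> i. f (x $ i))"

definition even_lattice :: "int^'n^'n \<Rightarrow> bool" where
  "even_lattice G \<longleftrightarrow>
     (\<forall>x y :: int^'n. bform G x y = bform G y x) \<and>
     (\<forall>x :: int^'n. even (bform G x x)) \<and>
     (\<forall>x :: int^'n. (\<forall>y :: int^'n. bform G x y = 0) \<longrightarrow> x = 0)"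

definition has_signature :: "int^'n^'n \<Rightarrow> nat \<Rightarrow> nat \<Rightarrow> bool" where
  "has_signature G p q \<longleftrightarrow>
     (\<exists>b :: 'n \<Rightarrow> real^'n. inj b \<and> independent (range b) \<and>
        (\<forall>i j. i \<noteq> j \<longrightarrow> bform G (b i) (b j) = 0) \<and>
        card {i. bform G (b i) (b i) > 0} = p \<and>
        card {i. bform G (b i) (b i) < 0} = q \<and> p + q = CARD('n))"

definition hyperbolic_pair :: "int^'n^'n \<Rightarrow> int^'n \<Rightarrow> int^'n \<Rightarrow> bool" where
  "hyperbolic_pair G e f \<longleftrightarrow> bform G e e = 0 \<and> bform G f f = 0 \<and> bform G e f = 1"

text \<open>\<open>L = U \<oplus> U \<oplus> L\<^sub>0\<close> as an internal orthogonal direct sum; \<open>L\<^sub>0 = 0\<close> is allowed.\<close>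

definition splits_two_hyperbolic_planes :: "int^'n^'n \<Rightarrow> bool" where
  "splits_two_hyperbolic_planes G \<longleftrightarrow>
     (\<exists>e f e' f' (L0 :: (int^'n) set).
        hyperbolic_pair G e f \<and> hyperbolic_pair G e' f' \<and>
        (\<forall>u\<in>{e, f}. \<forall>v\<in>{e', f'}. bform G u v = 0) \<and>
        0 \<in> L0 \<and> (\<forall>x\<in>L0. \<forall>y\<in>L0. x - y \<in> L0) \<and>
        (\<forall>u\<in>{e, f, e', f'}. \<forall>y\<in>L0. bform G u y = 0) \<and>
        bij_betw (\<lambda>(a, b, a', b', y). a *s e + b *s f + a' *s e' + b' *s f' + y)
          (UNIV \<times> UNIV \<times> UNIV \<times> UNIV \<times> L0) UNIV)"


section \<open>Orthogonal groups\<close>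

definition matrix_group :: "('a::comm_ring_1^'n^'n) set \<Rightarrow> ('a^'n^'n) monoid" where
  "matrix_group H = \<lparr>carrier = H, mult = (**), one = mat 1\<rparr>"

primrec mat_pow :: "'a::comm_ring_1^'n^'n \<Rightarrow> nat \<Rightarrow> 'a^'n^'n" where
  "mat_pow A 0 = mat 1"
| "mat_pow A (Suc k) = A ** mat_pow A k"

definition orth_group :: "int^'n^'n \<Rightarrow> ('a::comm_ring_1^'n^'n) set" where
  "orth_group G = {g. invertible g \<and> (\<forall>x y. bform G (g *v x) (g *v y) = bform G x y)}"

definition reflection :: "int^'n^'n \<Rightarrow> real^'n \<Rightarrow> real^'n \<Rightarrow> real^'n" where
  "reflection G v x = x - (2 * bform G x v / bform G v v) *s v"

text \<open>\<open>s\<close> represents the real spinor norm of \<open>g\<close>, a class modulo \<open>(\<real>\<^sup>\<times>)\<^sup>2\<close>.\<close>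

definition real_spinor_norm_rep :: "int^'n^'n \<Rightarrow> real^'n^'n \<Rightarrow> real \<Rightarrow> bool" where
  "real_spinor_norm_rep G g s \<longleftrightarrow>
     (\<exists>vs c. (\<forall>v\<in>set vs. bform G v v \<noteq> 0) \<and>
        (*v) g = foldr (\<circ>) (map (reflection G) vs) id \<and>
        c \<noteq> 0 \<and> s = (\<Prod>v\<leftarrow>vs. - (bform G v v / 2)) * c\<^sup>2)"

definition orth_plus_real :: "int^'n^'n \<Rightarrow> (real^'n^'n) set" where
  "orth_plus_real G = {g \<in> orth_group G. real_spinor_norm_rep G g 1}"

definition dual_lattice :: "int^'n^'n \<Rightarrow> (rat^'n) set" where
  "dual_lattice G = {x. \<forall>y :: int^'n. bform G x (map_vec of_int y) \<in> \<int>}"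

text \<open>
  The condition \<open>g x - x \<in> L\<close> for \<open>x \<in> L\<^sup>\<or>\<close> says that \<open>g\<close> fixes every class of
  \<open>D(L) = L\<^sup>\<or>/L\<close>.
\<close>

definition orth_tilde_plus :: "int^'n^'n \<Rightarrow> (int^'n^'n) set" where
  "orth_tilde_plus G =
     {g \<in> orth_group G.
        (\<forall>x\<in>dual_lattice G. map_matrix of_int g *v x - x \<in> range (map_vec of_int)) \<and>
        map_matrix of_int g \<in> orth_plus_real G}"

definition arithmetic_subgroup :: "int^'n^'n \<Rightarrow> (int^'n^'n) set \<Rightarrow> bool" where
  "arithmetic_subgroup G \<Gamma> \<longleftrightarrow>
     subgroup \<Gamma> (matrix_group (orth_tilde_plus G)) \<and>
     finite (rcosets\<^bsub>matrix_group (orth_tilde_plus G)\<^esub> \<Gamma>)"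


section \<open>The domain and its affine cone\<close>

text \<open>
  Points of \<open>\<P>(L \<otimes> \<complex>)\<close> are the sets of non-zero vectors of lines; the topology is the
  quotient topology from \<open>(L \<otimes> \<complex>) - {0}\<close>.
\<close>

definition proj_point :: "complex^'n \<Rightarrow> (complex^'n) set" where
  "proj_point Z = {s *s Z | s. s \<noteq> 0}"

definition proj_topology :: "(complex^'n) set topology" where
  "proj_topology =
     topology (\<lambda>W. W \<subseteq> proj_point ` (- {0}) \<and> open {Z. Z \<noteq> 0 \<and> proj_point Z \<in> W})"

lemma openin_proj_topology:
  "openin proj_topology W \<longleftrightarrow>
     W \<subseteq> proj_point ` (- {0 :: complex^'n}) \<and> open {Z. Z \<noteq> 0 \<and> proj_point Z \<in> W}"
proof -
  let ?P = "\<lambda>W. W \<subseteq> proj_point ` (- {0 :: complex^'n}) \<and> open {Z. Z \<noteq> 0 \<and> proj_point Z \<in> W}"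
  have "istopology ?P"
    unfolding istopology_def
  proof (intro conjI allI impI)
    fix S T assume "?P S" "?P T"
    moreover have "{Z. Z \<noteq> 0 \<and> proj_point Z \<in> S \<inter> T} =
        {Z. Z \<noteq> 0 \<and> proj_point Z \<in> S} \<inter> {Z. Z \<noteq> 0 \<and> proj_point Z \<in> T}" by auto
    ultimately show "S \<inter> T \<subseteq> proj_point ` (- {0 :: complex^'n})"
      and "open {Z. Z \<noteq> 0 \<and> proj_point Z \<in> S \<inter> T}" by auto
  next
    fix K assume K: "\<forall>S\<in>K. ?P S"
    have "{Z. Z \<noteq> 0 \<and> proj_point Z \<in> \<Union>K} = (\<Union>S\<in>K. {Z. Z \<noteq> 0 \<and> proj_point Z \<in> S})" by auto
    with K show "\<Union>K \<subseteq> proj_point ` (- {0 :: complex^'n})"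
      and "open {Z. Z \<noteq> 0 \<and> proj_point Z \<in> \<Union>K}" by auto
  qed
  then show ?thesis
    unfolding proj_topology_def by (simp add: topology_inverse')
qed

definition is_domain :: "int^'n^'n \<Rightarrow> (complex^'n) set set \<Rightarrow> bool" where
  "is_domain G D \<longleftrightarrow>
     D \<in> connected_components_of (subtopology proj_topology
       {proj_point Z | Z. Z \<noteq> 0 \<and> bform G Z Z = 0 \<and> Re (bform G Z (map_vec cnj Z)) > 0})"

text \<open>\<open>bform G Z (map_vec cnj Z)\<close> is a real number, so passing to \<open>Re\<close> loses nothing.\<close>

definition affine_cone :: "(complex^'n) set set \<Rightarrow> (complex^'n) set" where
  "affine_cone D = {Z. Z \<noteq> 0 \<and> proj_point Z \<in> D}"


section \<open>Cusps and toroidal boundary divisors\<close>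

text \<open>A cusp \<open>F\<close> is encoded by its totally isotropic subspace \<open>E \<subseteq> L \<otimes> \<rat>\<close>.\<close>

definition is_cusp :: "int^'n^'n \<Rightarrow> (rat^'n) set \<Rightarrow> bool" where
  "is_cusp G E \<longleftrightarrow>
     vec.subspace E \<and> E \<noteq> {0} \<and> (\<forall>x\<in>E. \<forall>y\<in>E. bform G x y = 0)"

definition cusp_stabiliser :: "int^'n^'n \<Rightarrow> (rat^'n) set \<Rightarrow> (real^'n^'n) set" where
  "cusp_stabiliser G E =
     {g \<in> orth_plus_real G.
        (*v) g ` span (map_vec of_rat ` E) = span (map_vec of_rat ` E)}"

definition nilpotent_mat :: "'a::comm_ring_1^'n^'n \<Rightarrow> bool" where
  "nilpotent_mat A \<longleftrightarrow> (\<exists>k. mat_pow A k = 0)"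

text \<open>
  The largest normal subgroup consisting of unipotent elements.  In characteristic \<open>0\<close>
  the Zariski closure of a normal unipotent subgroup is normal, unipotent and connected, so
  neither closedness nor connectedness has to be imposed.
\<close>

definition unipotent_radical :: "(real^'n^'n) set \<Rightarrow> (real^'n^'n) set" where
  "unipotent_radical P =
     \<Union>{H. H \<lhd> matrix_group P \<and> (\<forall>h\<in>H. nilpotent_mat (h - mat 1))}"

definition matrix_centre :: "('a::comm_ring_1^'n^'n) set \<Rightarrow> ('a^'n^'n) set" where
  "matrix_centre H = {z \<in> H. \<forall>h\<in>H. z ** h = h ** z}"

definition cusp_U :: "int^'n^'n \<Rightarrow> (rat^'n) set \<Rightarrow> (real^'n^'n) set" where
  "cusp_U G E = matrix_centre (unipotent_radical (cusp_stabiliser G E))"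

definition cusp_U_int :: "int^'n^'n \<Rightarrow> (int^'n^'n) set \<Rightarrow> (rat^'n) set \<Rightarrow> (int^'n^'n) set" where
  "cusp_U_int G \<Gamma> E = {r \<in> \<Gamma>. map_matrix of_int r \<in> cusp_U G E}"

definition mat_exp :: "'a::real_normed_field^'n^'n \<Rightarrow> 'a^'n^'n" where
  "mat_exp A = (\<Sum>k. mat_pow A k /\<^sub>R fact k)"

text \<open>The complex matrix \<open>exp(zN)\<close> for a real matrix \<open>N\<close>.\<close>

definition one_param :: "real^'n^'n \<Rightarrow> complex \<Rightarrow> complex^'n^'n" where
  "one_param N z = mat_exp (map_matrix (\<lambda>x. z * of_real x) N)"

text \<open>
  \<open>r = exp N\<close> is an element of \<open>U(F)\<^sub>\<int>\<close> giving a toroidal boundary divisor over the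
  cusp \<open>E\<close>.  The nilpotent logarithm \<open>N\<close> is determined by \<open>r\<close>.
\<close>

definition boundary_divisor ::
  "int^'n^'n \<Rightarrow> (complex^'n) set set \<Rightarrow> (int^'n^'n) set \<Rightarrow> (rat^'n) set \<Rightarrow>
   int^'n^'n \<Rightarrow> real^'n^'n \<Rightarrow> bool" where
  "boundary_divisor G D \<Gamma> E r N \<longleftrightarrow>
     r \<in> cusp_U_int G \<Gamma> E \<and> r \<noteq> mat 1 \<and>
     (\<forall>s\<in>cusp_U_int G \<Gamma> E. \<forall>k. r = mat_pow s k \<longrightarrow> k = 1) \<and>
     nilpotent_mat N \<and> map_matrix of_int r = mat_exp N \<and>
     (\<forall>z. Im z \<ge> 0 \<longrightarrow> (\<forall>Z\<in>affine_cone D. one_param N z *v Z \<in> affine_cone D))"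


section \<open>Modular forms and orders of vanishing\<close>

text \<open>
  Holomorphy on the complex submanifold \<open>S\<close> of \<open>\<complex>\<^sup>n\<close>, which is not open: locally \<open>\<psi>\<close> is the
  restriction of a holomorphic function on an open subset of \<open>\<complex>\<^sup>n\<close>.
\<close>

definition holomorphic_on_submanifold ::
  "(complex^'n \<Rightarrow> complex) \<Rightarrow> (complex^'n) set \<Rightarrow> bool" where
  "holomorphic_on_submanifold \<psi> S \<longleftrightarrow>
     (\<forall>Z\<in>S. \<exists>W h. open W \<and> Z \<in> W \<and> (\<forall>Y\<in>W \<inter> S. h Y = \<psi> Y) \<and>
        (\<forall>Y\<in>W. \<exists>a :: complex^'n.
           (h has_derivative (\<lambda>v. \<Sum>i\<in>UNIV. a $ i * v $ i)) (at Y)))"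

definition finite_order_character :: "(int^'n^'n) set \<Rightarrow> (int^'n^'n \<Rightarrow> complex) \<Rightarrow> bool" where
  "finite_order_character \<Gamma> \<eta> \<longleftrightarrow>
     (\<forall>g\<in>\<Gamma>. \<forall>h\<in>\<Gamma>. \<eta> (g ** h) = \<eta> g * \<eta> h) \<and>
     (\<exists>d>0. \<forall>g\<in>\<Gamma>. \<eta> g ^ d = 1)"

text \<open>
  \<open>c\<close> is the family of coefficients, indexed by \<open>a + \<int>\<close>, of the expansion of \<open>\<psi>\<close> along
  \<open>exp(zN)\<close>.  On the affine cone the coefficients with index in \<open>a + \<int>\<close> are uniquely
  determined.
\<close>

definition expansion ::
  "(complex^'n) set set \<Rightarrow> (complex^'n \<Rightarrow> complex) \<Rightarrow> real^'n^'n \<Rightarrow> rat \<Rightarrow>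
   (rat \<Rightarrow> complex^'n \<Rightarrow> complex) \<Rightarrow> bool" where
  "expansion D \<psi> N a c \<longleftrightarrow>
     (\<forall>z. Im z \<ge> 0 \<longrightarrow> (\<forall>Z\<in>affine_cone D.
        ((\<lambda>m. c m Z * exp (2 * of_real pi * \<i> * of_rat m * z)) has_sum
           \<psi> (one_param N z *v Z)) {m. m - a \<in> \<int>}))"

definition holomorphic_at_cusps ::
  "int^'n^'n \<Rightarrow> (complex^'n) set set \<Rightarrow> (int^'n^'n) set \<Rightarrow> (int^'n^'n \<Rightarrow> complex) \<Rightarrow>
   (complex^'n \<Rightarrow> complex) \<Rightarrow> bool" where
  "holomorphic_at_cusps G D \<Gamma> \<eta> \<psi> \<longleftrightarrow>
     (\<forall>E r N a c. is_cusp G E \<longrightarrow> boundary_divisor G D \<Gamma> E r N \<longrightarrow>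
        \<eta> r = exp (2 * of_real pi * \<i> * of_rat a) \<longrightarrow> expansion D \<psi> N a c \<longrightarrow>
        (\<forall>m. m - a \<in> \<int> \<longrightarrow> m < 0 \<longrightarrow> (\<forall>Z\<in>affine_cone D. c m Z = 0)))"

definition modular_form ::
  "int^'n^'n \<Rightarrow> (complex^'n) set set \<Rightarrow> (int^'n^'n) set \<Rightarrow> int \<Rightarrow> (int^'n^'n \<Rightarrow> complex) \<Rightarrow>
   (complex^'n \<Rightarrow> complex) \<Rightarrow> bool" where
  "modular_form G D \<Gamma> k \<eta> \<psi> \<longleftrightarrow>
     finite_order_character \<Gamma> \<eta> \<and>
     holomorphic_on_submanifold \<psi> (affine_cone D) \<and>
     (\<forall>s Z. s \<noteq> 0 \<longrightarrow> Z \<in> affine_cone D \<longrightarrow> \<psi> (s *s Z) = s powi (- k) * \<psi> Z) \<and>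
     (\<forall>g\<in>\<Gamma>. \<forall>Z\<in>affine_cone D. \<psi> (map_matrix of_int g *v Z) = \<eta> g * \<psi> Z) \<and>
     holomorphic_at_cusps G D \<Gamma> \<eta> \<psi>"

text \<open>\<open>m\<close> is the order of vanishing along the boundary divisor given by \<open>r = exp N\<close>.\<close>

definition has_vanishing_order ::
  "(complex^'n) set set \<Rightarrow> (int^'n^'n \<Rightarrow> complex) \<Rightarrow> (complex^'n \<Rightarrow> complex) \<Rightarrow>
   int^'n^'n \<Rightarrow> real^'n^'n \<Rightarrow> rat \<Rightarrow> bool" where
  "has_vanishing_order D \<eta> \<psi> r N m \<longleftrightarrow>
     (\<exists>a c. \<eta> r = exp (2 * of_real pi * \<i> * of_rat a) \<and> expansion D \<psi> N a c \<and>
        m - a \<in> \<int> \<and> (\<exists>Z\<in>affine_cone D. c m Z \<noteq> 0) \<and>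
        (\<forall>m'. m' - a \<in> \<int> \<longrightarrow> m' < m \<longrightarrow> (\<forall>Z\<in>affine_cone D. c m' Z = 0)))"

end

theory Submission
  imports Defs "HOL-Complex_Analysis.Complex_Residues"
begin

text \<open>
  The element \<open>r = exp N\<close> is unipotent: \<open>det r = det (exp (N/2))\<^sup>2 \<ge> 0\<close> is a unit of \<open>\<int>\<close>, so
  \<open>det r = 1\<close> and both characters are trivial on \<open>r\<close>.  Hence \<open>\<psi> (exp (z N) Z)\<close> has period \<open>1\<close> in
  \<open>z\<close> and descends to a function of \<open>q = e\<^bsup>2\<pi>iz\<^esup>\<close> on \<open>0 < \<bar>q\<bar> \<le> 1\<close>.  Because \<open>\<psi>\<close> is holomorphic near
  every point of the cone, this function extends holomorphically across the unit circle, and its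
  Laurent series at \<open>q = 0\<close> is the required expansion, with exponents in \<open>\<int>\<close>.
\<close>

section \<open>Laurent and Fourier series\<close>

text \<open>The majorant \<open>M\<close> makes the finite partial sums converge uniformly on the
  circle (Weierstrass test), so integral and limit commute. The limit runs along the net of finite
  subsets of \<open>I\<close>, since \<open>has_sum\<close> fixes no order of summation.\<close>

lemma has_sum_contour_integral_circlepath:
  fixes u :: "'a \<Rightarrow> complex \<Rightarrow> complex"
  assumes "0 < r"
    and cont: "\<And>k. k \<in> I \<Longrightarrow> continuous_on (sphere z r) (u k)"
    and bound: "\<And>k w. k \<in> I \<Longrightarrow> w \<in> sphere z r \<Longrightarrow> norm (u k w) \<le> M k"
    and summable: "M summable_on I"
    and sum: "\<And>w. w \<in> sphere z r \<Longrightarrow> ((\<lambda>k. u k w) has_sum s w) I"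
  shows "((\<lambda>k. contour_integral (circlepath z r) (u k)) has_sum
           contour_integral (circlepath z r) s) I"
proof -
  have int: "u k contour_integrable_on circlepath z r" if "k \<in> I" for k
    using cont[OF that] \<open>0 < r\<close> by (intro contour_integrable_continuous_circlepath) simp
  have ev: "\<forall>\<^sub>F X in finite_subsets_at_top I. finite X \<and> X \<subseteq> I"
    by (rule eventually_finite_subsets_at_top_weakI) auto
  have "((\<lambda>X. contour_integral (circlepath z r) (\<lambda>w. \<Sum>k\<in>X. u k w))
          \<longlongrightarrow> contour_integral (circlepath z r) s) (finite_subsets_at_top I)"
  proof (rule contour_integral_uniform_limit_circlepath(2))
    show "\<forall>\<^sub>F X in finite_subsets_at_top I.
        (\<lambda>w. \<Sum>k\<in>X. u k w) contour_integrable_on circlepath z r"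
      using ev by eventually_elim (auto intro!: contour_integrable_sum int)
    show "uniform_limit (sphere z r) (\<lambda>X w. \<Sum>k\<in>X. u k w) s (finite_subsets_at_top I)"
      using bound sum summable by (rule Weierstrass_m_test_general')
  qed (use \<open>0 < r\<close> in auto)
  moreover have "\<forall>\<^sub>F X in finite_subsets_at_top I.
      contour_integral (circlepath z r) (\<lambda>w. \<Sum>k\<in>X. u k w) =
      (\<Sum>k\<in>X. contour_integral (circlepath z r) (u k))"
    using ev by eventually_elim (auto intro!: contour_integral_sum int)
  ultimately show ?thesis
    unfolding has_sum_def by (rule Lim_transform_eventually)
qed

lemma has_sum_geometric:
  fixes x :: complex
  assumes "norm x < 1"
  shows "((\<lambda>k. x ^ k) has_sum 1 / (1 - x)) UNIV"
proof (rule norm_summable_imp_has_sum)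
  show "summable (\<lambda>k. norm (x ^ k))"
    unfolding norm_power by (rule summable_geometric) (use assms in simp)
  show "(\<lambda>k. x ^ k) sums (1 / (1 - x))"
    by (rule geometric_sums) (rule assms)
qed

lemma summable_on_geometric_real:
  fixes x :: real
  assumes "0 \<le> x" "x < 1"
  shows "(\<lambda>k. c * x ^ k) summable_on (UNIV :: nat set)"
proof (intro summable_on_cmult_right norm_summable_imp_summable_on)
  show "summable (\<lambda>k. norm (x ^ k))"
    unfolding norm_power by (rule summable_geometric) (use assms in simp)
qed

lemma atLeast_0_int: "{0..} = range int"
  by (auto simp: image_iff intro!: exI[of _ "nat _"])

text \<open>The shift by one lets the principal part, like the regular part, be indexed by naturals
  from 0, as the geometric series are.\<close>

lemma lessThan_0_int: "{..<0} = range (\<lambda>k. - int k - 1)"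
  by (auto simp: image_iff intro!: exI[of _ "nat (- _ - 1)"])

section \<open>Laurent expansion at an isolated singularity\<close>

text \<open>For \<open>m \<ge> 0\<close> the coefficient is computed on a circle outside \<open>q\<close>, for \<open>m < 0\<close> on one
  inside \<open>q\<close>, so that the geometric series of the Cauchy kernel converges in both cases.\<close>

theorem Laurent_series_punctured_ball:
  assumes F: "F holomorphic_on ball 0 R - {0}" and q: "q \<noteq> 0" "norm q < R"
  shows "((\<lambda>m. residue (\<lambda>w. F w * w powi (- m - 1)) 0 * q powi m) has_sum F q) UNIV"
proof -
  define b where "b m = residue (\<lambda>w. F w * w powi (- m - 1)) 0" for m
  have R: "0 < R"
    using q by (meson norm_ge_zero le_less_trans)
  \<comment> \<open>Two radii with \<open>0 < r < norm q < \<rho> < R\<close>: the circles bound an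
    annulus around \<open>q\<close>.\<close>
  define r where "r = norm q / 2"
  define \<rho> where "\<rho> = (norm q + R) / 2"
  have r: "0 < r" "r < norm q" and \<rho>: "0 < \<rho>" "norm q < \<rho>" "\<rho> < R"
    using q R by (auto simp: r_def \<rho>_def add_nonneg_pos)
  have contF: "continuous_on (sphere 0 s) F" if "0 < s" "s < R" for s
    using holomorphic_on_imp_continuous_on[OF F] by (rule continuous_on_subset) (use that in auto)
  \<comment> \<open>By the residue theorem the integral does not depend on the radius, so both
    circles yield the same coefficients \<open>b m\<close>.\<close>
  have b: "contour_integral (circlepath 0 s) (\<lambda>w. F w * w powi (- m - 1)) = 2 * pi * \<i> * b m"
    if "0 < s" "s < R" for s m
    unfolding b_def
    by (intro contour_integral_unique base_residue[of "ball 0 R"])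
      (use that R in \<open>auto intro!: holomorphic_intros F\<close>)
  have bounded: "\<exists>C. \<forall>w\<in>sphere 0 s. norm (F w) \<le> C" if s: "0 < s" "s < R" for s
  proof -
    have "compact (F ` sphere 0 s)"
      by (intro compact_continuous_image contF that) auto
    then have "bounded (F ` sphere 0 s)"
      by (rule compact_imp_bounded)
    then show ?thesis
      by (auto simp: bounded_iff)
  qed
  have outer: "((\<lambda>m. 2 * pi * \<i> * b m * q powi m) has_sum
      contour_integral (circlepath 0 \<rho>) (\<lambda>w. F w / (w - q))) {0..}"
  proof -
    obtain C where C: "\<And>w. w \<in> sphere 0 \<rho> \<Longrightarrow> norm (F w) \<le> C"
      using bounded[of \<rho>] \<rho> by blast
    have "((\<lambda>k. contour_integral (circlepath 0 \<rho>) (\<lambda>w. F w * w powi (- int k - 1) * q powi int k))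
        has_sum contour_integral (circlepath 0 \<rho>) (\<lambda>w. F w / (w - q))) UNIV"
    proof (rule has_sum_contour_integral_circlepath)
      fix k
      show "continuous_on (sphere 0 \<rho>) (\<lambda>w. F w * w powi (- int k - 1) * q powi int k)"
        using \<rho> by (intro continuous_intros contF) auto
    next
      fix k and w :: complex
      assume w: "w \<in> sphere 0 \<rho>"
      then have w0: "w \<noteq> 0" using \<rho> by auto
      have "norm (F w * w powi (- int k - 1) * q powi int k) = norm (F w) / \<rho> * (norm q / \<rho>) ^ k"
        using w w0 by (simp add: norm_mult norm_power norm_divide power_int_diff power_int_minus
            power_divide norm_inverse field_simps)
      also have "\<dots> \<le> C / \<rho> * (norm q / \<rho>) ^ k"
        using C[OF w] \<rho> by (intro mult_right_mono divide_right_mono) auto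
      finally show "norm (F w * w powi (- int k - 1) * q powi int k) \<le> C / \<rho> * (norm q / \<rho>) ^ k" .
    next
      show "(\<lambda>k. C / \<rho> * (norm q / \<rho>) ^ k) summable_on UNIV"
        by (rule summable_on_geometric_real) (use \<rho> in auto)
    next
      fix w :: complex
      assume w: "w \<in> sphere 0 \<rho>"
      then have w0: "w \<noteq> 0" "w \<noteq> q" "norm (q / w) < 1" using \<rho> by (auto simp: norm_divide)
      \<comment> \<open>On the outer circle \<open>1 / (w - q)\<close> is expanded in powers of
        \<open>q / w\<close>.\<close>
      have "((\<lambda>k. F w / w * (q / w) ^ k) has_sum F w / w * (1 / (1 - q / w))) UNIV"
        by (intro has_sum_cmult_right has_sum_geometric w0)
      also have "(\<lambda>k. F w / w * (q / w) ^ k) = (\<lambda>k. F w * w powi (- int k - 1) * q powi int k)"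
        using w0 by (auto simp: power_int_diff power_int_minus power_divide field_simps)
      also have "F w / w * (1 / (1 - q / w)) = F w / (w - q)"
        using w0 by (simp add: field_simps)
      finally show "((\<lambda>k. F w * w powi (- int k - 1) * q powi int k) has_sum F w / (w - q)) UNIV" .
    qed (use \<rho> in auto)
    also have "(\<lambda>k. contour_integral (circlepath 0 \<rho>) (\<lambda>w. F w * w powi (- int k - 1) * q powi int k))
        = (\<lambda>k. 2 * pi * \<i> * b (int k) * q powi int k)"
    proof
      fix k
      have "(\<lambda>w. F w * w powi (- int k - 1)) contour_integrable_on circlepath 0 \<rho>"
        using \<rho> by (intro contour_integrable_continuous_circlepath) (auto intro!: continuous_intros contF)
      then show "contour_integral (circlepath 0 \<rho>) (\<lambda>w. F w * w powi (- int k - 1) * q powi int k)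
        = 2 * pi * \<i> * b (int k) * q powi int k"
        by (subst contour_integral_rmul) (use b[of \<rho> "int k"] \<rho> in simp_all)
    qed
    finally show ?thesis
      unfolding atLeast_0_int by (subst has_sum_reindex) (auto simp: inj_on_def o_def)
  qed
  have inner: "((\<lambda>m. 2 * pi * \<i> * b m * q powi m) has_sum
      contour_integral (circlepath 0 r) (\<lambda>w. F w / (q - w))) {..<0}"
  proof -
    have rR: "r < R" using r q by simp
    obtain C where C: "\<And>w. w \<in> sphere 0 r \<Longrightarrow> norm (F w) \<le> C"
      using bounded[of r] r rR by blast
    have "((\<lambda>k. contour_integral (circlepath 0 r) (\<lambda>w. F w * w ^ k * q powi (- int k - 1)))
        has_sum contour_integral (circlepath 0 r) (\<lambda>w. F w / (q - w))) UNIV"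
    proof (rule has_sum_contour_integral_circlepath)
      fix k
      show "continuous_on (sphere 0 r) (\<lambda>w. F w * w ^ k * q powi (- int k - 1))"
        using r rR q by (intro continuous_intros contF) auto
    next
      fix k and w :: complex
      assume w: "w \<in> sphere 0 r"
      have "norm (F w * w ^ k * q powi (- int k - 1)) = norm (F w) / norm q * (r / norm q) ^ k"
        using w q by (simp add: norm_mult norm_power norm_divide power_int_diff power_int_minus
            power_divide norm_inverse field_simps)
      also have "\<dots> \<le> C / norm q * (r / norm q) ^ k"
        using C[OF w] r by (intro mult_right_mono divide_right_mono) auto
      finally show "norm (F w * w ^ k * q powi (- int k - 1)) \<le> C / norm q * (r / norm q) ^ k" .
    next
      show "(\<lambda>k. C / norm q * (r / norm q) ^ k) summable_on UNIV"
        by (rule summable_on_geometric_real) (use r q in auto)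
    next
      fix w :: complex
      assume w: "w \<in> sphere 0 r"
      then have w0: "w \<noteq> q" "norm (w / q) < 1" using r q by (auto simp: norm_divide)
      \<comment> \<open>On the inner circle \<open>1 / (q - w)\<close> is expanded in powers of
        \<open>w / q\<close>; the sign of the kernel is reversed, so the two integrals are added
        below.\<close>
      have "((\<lambda>k. F w / q * (w / q) ^ k) has_sum F w / q * (1 / (1 - w / q))) UNIV"
        by (intro has_sum_cmult_right has_sum_geometric w0)
      also have "(\<lambda>k. F w / q * (w / q) ^ k) = (\<lambda>k. F w * w ^ k * q powi (- int k - 1))"
        using q by (auto simp: power_int_diff power_int_minus power_divide field_simps)
      also have "F w / q * (1 / (1 - w / q)) = F w / (q - w)"
        using w0 q by (simp add: field_simps)
      finally show "((\<lambda>k. F w * w ^ k * q powi (- int k - 1)) has_sum F w / (q - w)) UNIV" .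
    qed (use r in auto)
    also have "(\<lambda>k. contour_integral (circlepath 0 r) (\<lambda>w. F w * w ^ k * q powi (- int k - 1)))
        = (\<lambda>k. 2 * pi * \<i> * b (- int k - 1) * q powi (- int k - 1))"
    proof
      fix k
      have "(\<lambda>w. F w * w ^ k) contour_integrable_on circlepath 0 r"
        using r rR by (intro contour_integrable_continuous_circlepath) (auto intro!: continuous_intros contF)
      then show "contour_integral (circlepath 0 r) (\<lambda>w. F w * w ^ k * q powi (- int k - 1))
        = 2 * pi * \<i> * b (- int k - 1) * q powi (- int k - 1)"
        by (subst contour_integral_rmul) (use b[of r "- int k - 1"] r rR in simp_all)
    qed
    finally show ?thesis
      unfolding lessThan_0_int by (subst has_sum_reindex) (auto simp: inj_on_def o_def)
  qed
  have cauchy: "contour_integral (circlepath 0 \<rho>) (\<lambda>w. F w / (w - q)) +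
      contour_integral (circlepath 0 r) (\<lambda>w. F w / (q - w)) = 2 * pi * \<i> * F q"
  proof -
    \<comment> \<open>Cauchy's formula for the annulus is reduced to one residue: the difference
      quotient \<open>H\<close> has a removable singularity at \<open>q\<close>, so it has the same
      integral over both circles and cancels. What remains, \<open>F q / (w - q)\<close>,
      contributes only on the outer circle.\<close>
    define H where "H w = (if w = q then deriv F q else (F w - F q) / (w - q))" for w
    have "H holomorphic_on ball 0 R - {0}"
      unfolding H_def using F by (rule pole_lemma_open) auto
    then have H: "(H has_contour_integral 2 * pi * \<i> * residue H 0) (circlepath 0 s)"
      if "0 < s" "s < R" for s
      by (intro base_residue[of "ball 0 R"]) (use that R in auto)
    have H': "((\<lambda>w. (F w - F q) / (w - q)) has_contour_integral 2 * pi * \<i> * residue H 0)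
        (circlepath 0 s)" if s: "0 < s" "s < R" "s \<noteq> norm q" for s
      using H[OF s(1,2)] by (rule has_contour_integral_eq) (use s in \<open>auto simp: H_def\<close>)
    have "((\<lambda>w. F q / (w - q)) has_contour_integral 2 * of_real pi * \<i> * F q) (circlepath 0 \<rho>)"
      by (rule Cauchy_integral_circlepath_simple) (use \<rho> in auto)
    then have "((\<lambda>w. (F w - F q) / (w - q) + F q / (w - q)) has_contour_integral
        2 * pi * \<i> * residue H 0 + 2 * of_real pi * \<i> * F q) (circlepath 0 \<rho>)"
      by (intro has_contour_integral_add H') (use \<rho> in auto)
    then have 1: "contour_integral (circlepath 0 \<rho>) (\<lambda>w. F w / (w - q)) =
        2 * pi * \<i> * residue H 0 + 2 * pi * \<i> * F q"
      by (intro contour_integral_unique) (simp add: diff_divide_distrib)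
    have "((\<lambda>w. F q / (q - w)) has_contour_integral 0) (circlepath 0 r)"
      by (rule Cauchy_theorem_disc_simple[of _ 0 "norm q"])
        (use r in \<open>auto intro!: holomorphic_intros\<close>)
    moreover have "((\<lambda>w. - ((F w - F q) / (w - q))) has_contour_integral
        - (2 * pi * \<i> * residue H 0)) (circlepath 0 r)"
      using r q by (intro has_contour_integral_neg H') auto
    ultimately have "((\<lambda>w. - ((F w - F q) / (w - q)) + F q / (q - w)) has_contour_integral
        - (2 * pi * \<i> * residue H 0) + 0) (circlepath 0 r)"
      by (intro has_contour_integral_add)
    moreover have "- ((F w - F q) / (w - q)) + F q / (q - w) = F w / (q - w)" for w
    proof -
      have "q - w = - (w - q)" by simp
      then show ?thesis
        by (simp only: divide_minus_right) (simp add: diff_divide_distrib)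
    qed
    ultimately have 2: "contour_integral (circlepath 0 r) (\<lambda>w. F w / (q - w)) =
        - (2 * pi * \<i> * residue H 0)"
      by (intro contour_integral_unique) simp
    show ?thesis
      unfolding 1 2 by simp
  qed
  have "((\<lambda>m. 2 * pi * \<i> * b m * q powi m) has_sum 2 * pi * \<i> * F q) ({0..} \<union> {..<0})"
    unfolding cauchy[symmetric] by (intro has_sum_Un_disjoint outer inner) auto
  also have "{0..} \<union> {..<0} = (UNIV :: int set)" by auto
  finally have "((\<lambda>m. 2 * pi * \<i> * (b m * q powi m)) has_sum 2 * pi * \<i> * F q) UNIV"
    by (simp only: mult.assoc)
  then have "((\<lambda>m. b m * q powi m) has_sum F q) UNIV"
    by (subst (asm) has_sum_cmult_right_iff) auto
  then show ?thesis
    by (simp add: b_def)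
qed

section \<open>Uniqueness of Laurent coefficients\<close>

text \<open>Every power except the one with exponent -1 has a single-valued primitive off 0.\<close>

lemma contour_integral_circlepath_powi:
  "contour_integral (circlepath 0 1) (\<lambda>w. w powi m) = (if m = - 1 then 2 * pi * \<i> else 0)"
proof (cases "m = -1")
  case True
  have "((\<lambda>w. 1 / (w - 0)) has_contour_integral 2 * of_real pi * \<i> * 1) (circlepath 0 1)"
    by (rule Cauchy_integral_circlepath_simple) auto
  then show ?thesis
    using True by (intro contour_integral_unique) (simp add: field_simps)
next
  case False
  have "((\<lambda>w. w powi m) has_contour_integral
      (pathfinish (circlepath 0 1) powi (m + 1) / of_int (m + 1) -
       pathstart (circlepath 0 1) powi (m + 1) / of_int (m + 1))) (circlepath 0 1)"
  proof (rule contour_integral_primitive[where S = "- {0}"])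
    fix w :: complex
    assume "w \<in> - {0}"
    moreover have "(of_int m + 1 :: complex) \<noteq> 0"
      using False by (metis add.commute add_eq_0_iff of_int_1 of_int_add of_int_eq_0_iff)
    ultimately show "((\<lambda>w. w powi (m + 1) / of_int (m + 1)) has_field_derivative w powi m)
        (at w within - {0})"
      by (auto intro!: derivative_eq_intros)
  qed auto
  then show ?thesis
    using False by (intro contour_integral_unique) simp
qed

text \<open>Multiplying by \<open>w powi (- m - 1)\<close> moves the index \<open>m\<close> to the
  exponent -1, the only one that survives integration over the unit circle.\<close>

lemma Laurent_coeffs_unique:
  fixes b :: "int \<Rightarrow> complex"
  assumes sum: "\<And>q. norm q = 1 \<Longrightarrow> ((\<lambda>m. b m * q powi m) has_sum 0) UNIV"
  shows "b m = 0"
proof -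
  have "((\<lambda>k. contour_integral (circlepath 0 1) (\<lambda>w. b k * w powi (k - m - 1))) has_sum
      contour_integral (circlepath 0 1) (\<lambda>w. 0)) UNIV"
  proof (rule has_sum_contour_integral_circlepath)
    show "continuous_on (sphere 0 1) (\<lambda>w. b k * w powi (k - m - 1))" for k
      by (intro continuous_intros) auto
    show "norm (b k * w powi (k - m - 1)) \<le> norm (b k)" if "w \<in> sphere 0 1" for k w
      using that by (simp add: norm_mult norm_power_int)
    \<comment> \<open>At \<open>q = 1\<close> the series is that of the coefficients themselves, and
      unordered summability in \<complex> is absolute. This supplies the majorant on the whole
      circle.\<close>
    show "(\<lambda>k. norm (b k)) summable_on UNIV"
      using sum[of 1]
      by (intro summable_on_iff_abs_summable_on_complex[THEN iffD1] has_sum_imp_summable) simp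
    show "((\<lambda>k. b k * w powi (k - m - 1)) has_sum 0) UNIV" if "w \<in> sphere 0 1" for w
    proof -
      have "w \<noteq> 0" "norm w = 1" using that by auto
      have "((\<lambda>k. b k * w powi k * w powi (- m - 1)) has_sum 0 * w powi (- m - 1)) UNIV"
        by (intro has_sum_cmult_left sum \<open>norm w = 1\<close>)
      moreover have "b k * w powi k * w powi (- m - 1) = b k * w powi (k - m - 1)" for k
        using \<open>w \<noteq> 0\<close> power_int_add[of w k "- m - 1"] by (simp add: algebra_simps)
      ultimately show ?thesis by simp
    qed
  qed auto
  moreover have "contour_integral (circlepath 0 1) (\<lambda>w. b k * w powi (k - m - 1)) =
      (if k = m then 2 * pi * \<i> * b m else 0)" for k
  proof -
    have "(\<lambda>w. w powi (k - m - 1)) contour_integrable_on circlepath 0 1"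
      by (intro contour_integrable_continuous_circlepath continuous_intros) auto
    then show ?thesis
      by (subst contour_integral_lmul) (auto simp: contour_integral_circlepath_powi)
  qed
  ultimately have "((\<lambda>k. if k = m then 2 * pi * \<i> * b m else 0) has_sum 0) UNIV"
    by simp
  moreover have "((\<lambda>k. if k = m then 2 * pi * \<i> * b m else 0) has_sum 2 * pi * \<i> * b m) UNIV"
    using has_sum_finite_neutralI[of "{m}" UNIV "\<lambda>k. if k = m then 2 * pi * \<i> * b m else 0"]
    by simp
  ultimately have "2 * pi * \<i> * b m = 0"
    by (rule has_sum_unique[symmetric])
  then show ?thesis by simp
qed

section \<open>Holomorphic extension across the unit circle\<close>

lemma holomorphic_on_locally:
  assumes "\<And>z. z \<in> S \<Longrightarrow> \<exists>T g. open T \<and> z \<in> T \<and> g holomorphic_on T \<and> (\<forall>w\<in>T. f w = g w)"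
  shows "f holomorphic_on S"
proof -
  have "f analytic_on {z}" if "z \<in> S" for z
    using assms[OF that] unfolding analytic_at by (metis holomorphic_cong)
  then show ?thesis
    using analytic_imp_holomorphic analytic_on_analytic_at by blast
qed

text \<open>By compactness of the unit circle, the local extensions have a common radius \<open>\<delta>\<close>; they agree
  on overlaps because two overlapping discs also overlap inside the unit disc.\<close>

lemma holomorphic_extension_across_unit_circle:
  fixes F :: "complex \<Rightarrow> complex"
  assumes loc: "\<And>p. p \<noteq> 0 \<Longrightarrow> norm p \<le> 1 \<Longrightarrow>
    \<exists>W g. open W \<and> p \<in> W \<and> g holomorphic_on W \<and> (\<forall>q\<in>W. norm q \<le> 1 \<longrightarrow> g q = F q)"
  obtains R H where "1 < R" "H holomorphic_on ball 0 R - {0}"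
    "\<And>q. q \<noteq> 0 \<Longrightarrow> norm q \<le> 1 \<Longrightarrow> H q = F q"
proof -
  define \<W> where "\<W> = {W. open W \<and> (\<exists>g. g holomorphic_on W \<and> (\<forall>q\<in>W. norm q \<le> 1 \<longrightarrow> g q = F q))}"
  have "sphere 0 1 \<subseteq> \<Union>\<W>"
  proof
    fix p :: complex
    assume "p \<in> sphere 0 1"
    then have "p \<noteq> 0" "norm p \<le> 1"
      by auto
    from loc[OF this] obtain W where "W \<in> \<W>" "p \<in> W"
      unfolding \<W>_def by blast
    then show "p \<in> \<Union>\<W>" by blast
  qed
  \<comment> \<open>\<open>\<delta>\<close> is a Lebesgue number of the cover
    \<open>\<W>\<close>.\<close>
  then obtain \<delta> where \<delta>: "0 < \<delta>"
    and cover: "\<And>p. p \<in> sphere 0 1 \<Longrightarrow> \<exists>W\<in>\<W>. ball p \<delta> \<subseteq> W"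
    by (rule Heine_Borel_lemma[of "sphere 0 1" \<W>, OF compact_sphere]) (auto simp: \<W>_def)
  have "\<exists>g. g holomorphic_on ball p \<delta> \<and> (\<forall>q\<in>ball p \<delta>. norm q \<le> 1 \<longrightarrow> g q = F q)"
    if "p \<in> sphere 0 1" for p
  proof -
    obtain W where "W \<in> \<W>" "ball p \<delta> \<subseteq> W"
      using cover \<open>p \<in> sphere 0 1\<close> by blast
    then show ?thesis
      unfolding \<W>_def by (blast intro: holomorphic_on_subset)
  qed
  then obtain g where g_holo: "\<And>p. p \<in> sphere 0 1 \<Longrightarrow> g p holomorphic_on ball p \<delta>"
    and g_eq: "\<And>p q. p \<in> sphere 0 1 \<Longrightarrow> q \<in> ball p \<delta> \<Longrightarrow> norm q \<le> 1 \<Longrightarrow> g p q = F q"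
    by metis
  \<comment> \<open>Outside the closed disc the value comes from the local extension centred at the
    radial projection \<open>sgn q\<close> of \<open>q\<close>.\<close>
  define H where "H q = (if norm q \<le> 1 then F q else g (sgn q) q)" for q
  \<comment> \<open>The condition \<open>p \<in> ball p' \<delta>\<close> puts the boundary point
    \<open>p\<close> itself into the intersection, which therefore meets the open unit disc, where
    both extensions equal \<open>F\<close>. The intersection is convex, hence connected, and the
    identity theorem applies.\<close>
  have compat: "g p q = g p' q"
    if p: "p \<in> sphere 0 1" "p' \<in> sphere 0 1" "p \<in> ball p' \<delta>"
      and q: "q \<in> ball p \<delta>" "q \<in> ball p' \<delta>" for p p' q
  proof -
    let ?A = "ball p \<delta> \<inter> ball p' \<delta>"
    show ?thesis
    proof (rule analytic_continuation_open[where s = "?A \<inter> ball 0 1" and s' = ?A and f = "g p" and g = "g p'"])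
      show "?A \<inter> ball 0 1 \<noteq> {}"
      proof -
        have "p \<in> ?A" "p \<in> closure (ball 0 1)"
          using p \<delta> by auto
        then show ?thesis
          using open_Int_closure_eq_empty[of ?A "ball 0 1"] by blast
      qed
      show "connected ?A"
        by (intro convex_connected convex_Int) auto
      show "g p holomorphic_on ?A" "g p' holomorphic_on ?A"
        using g_holo p by (blast intro: holomorphic_on_subset)+
      show "g p z = g p' z" if "z \<in> ?A \<inter> ball 0 1" for z
        using that g_eq p by auto
    qed (use q in auto)
  qed
  \<comment> \<open>The distance from \<open>q\<close> to its projection is
    \<open>norm q - 1\<close>, so \<open>H\<close> evaluates \<open>g (sgn q)\<close> only inside
    its disc of holomorphy.\<close>
  have radial: "q \<in> ball (sgn q) \<delta>" if "1 \<le> norm q" "norm q < 1 + \<delta>" for q :: complex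
  proof -
    have "q \<noteq> 0" using that by auto
    have "sgn q - q = (1 - norm q) *\<^sub>R sgn q"
      by (simp only: scaleR_diff_left) (simp add: sgn_div_norm \<open>q \<noteq> 0\<close>)
    then have "dist (sgn q) q = \<bar>1 - norm q\<bar>"
      using \<open>q \<noteq> 0\<close> by (simp add: dist_norm norm_sgn)
    then show ?thesis
      using that by simp
  qed
  have "H holomorphic_on ball 0 (1 + \<delta>) - {0}"
  proof (rule holomorphic_on_locally)
    fix q :: complex
    assume q: "q \<in> ball 0 (1 + \<delta>) - {0}"
    show "\<exists>T h. open T \<and> q \<in> T \<and> h holomorphic_on T \<and> (\<forall>w\<in>T. H w = h w)"
    proof (cases "norm q < 1")
      case True
      obtain W h where "open W" "q \<in> W" "h holomorphic_on W" "\<And>w. w \<in> W \<Longrightarrow> norm w \<le> 1 \<Longrightarrow> h w = F w"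
        using loc[of q] q True by auto
      then show ?thesis
        using True
        by (intro exI[of _ "W \<inter> ball 0 1"] exI[of _ h]) (auto simp: H_def intro: holomorphic_on_subset)
    next
      case False
      define p where "p = sgn q"
      have p: "p \<in> sphere 0 1"
        using q by (simp add: p_def norm_sgn)
      have qp: "q \<in> ball p \<delta>"
        unfolding p_def using q False by (intro radial) auto
      have sgn_cont: "continuous_on (- {0}) (sgn :: complex \<Rightarrow> complex)"
        by (intro continuous_intros) auto
      \<comment> \<open>The centre \<open>sgn w\<close> used by \<open>H\<close> varies with
        \<open>w\<close>. Keeping it in \<open>ball p \<delta>\<close> lets \<open>compat\<close>
        replace it by the fixed centre \<open>p\<close>, so that on \<open>T\<close> the function
        \<open>H\<close> is \<open>g p\<close> on both sides of the circle.\<close>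
      define T where "T = ball p \<delta> \<inter> ball 0 (1 + \<delta>) \<inter> (- {0} \<inter> sgn -` ball p \<delta>)"
      have "open T"
        unfolding T_def by (intro open_Int continuous_open_preimage sgn_cont) auto
      moreover have "q \<in> T"
        using qp q \<delta> by (auto simp: T_def p_def)
      moreover have "H w = g p w" if "w \<in> T" for w
      proof (cases "norm w \<le> 1")
        case True
        then show ?thesis
          using that p g_eq by (simp add: H_def T_def)
      next
        case False
        define p' where "p' = sgn w"
        have w: "w \<noteq> 0" "w \<in> ball p \<delta>" "p' \<in> ball p \<delta>"
          using that by (auto simp: T_def p'_def)
        have "w \<in> ball p' \<delta>" "p' \<in> sphere 0 1"
          using that False w radial[of w] by (auto simp: T_def p'_def norm_sgn)
        then show ?thesis
          using compat[of p' p w] w p False by (simp add: H_def p'_def)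
      qed
      ultimately show ?thesis
        using p g_holo by (intro exI[of _ T] exI[of _ "g p"]) (auto simp: T_def intro: holomorphic_on_subset)
    qed
  qed
  then show thesis
    using \<delta> by (intro that[of "1 + \<delta>" H]) (auto simp: H_def)
qed


section \<open>Exponentials of nilpotent matrices\<close>

lemma mat_pow_add: "mat_pow A (i + j) = mat_pow A i ** mat_pow A j"
  by (induction i) (simp_all add: matrix_mul_assoc)

lemma mat_pow_eq_0_mono: "mat_pow A K = 0 \<Longrightarrow> K \<le> k \<Longrightarrow> mat_pow A k = 0"
  using mat_pow_add[of A K "k - K"] by simp

lemma mat_pow_scale:
  "mat_pow (map_matrix ((*) s) A) k = map_matrix ((*) (s ^ k)) (mat_pow A k)"
proof (induction k)
  case 0
  then show ?case by (simp add: vec_eq_iff mat_def)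
next
  case (Suc k)
  then show ?case
    by (auto simp: vec_eq_iff matrix_matrix_mult_def sum_distrib_left mult_ac intro!: sum.cong)
qed

lemma mat_pow_map_of_real:
  "mat_pow (map_matrix of_real A) k = map_matrix of_real (mat_pow A k)"
proof (induction k)
  case 0
  then show ?case by (simp add: vec_eq_iff mat_def)
next
  case (Suc k)
  then show ?case
    by (auto simp: vec_eq_iff matrix_matrix_mult_def)
qed

lemma mat_exp_nilpotent:
  assumes "mat_pow A K = 0"
  shows "mat_exp A = (\<Sum>k<K. mat_pow A k /\<^sub>R fact k)"
  unfolding mat_exp_def
  by (rule suminf_finite) (use mat_pow_eq_0_mono[OF assms] in auto)

text \<open>The series terminates, so each entry is a polynomial in \<open>s\<close>. Later
  computations with exponentials use this form and raise no question of convergence.\<close>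

lemma mat_exp_scale_nth:
  fixes A :: "'a::real_normed_field^'n^'n"
  assumes "mat_pow A K = 0"
  shows "mat_exp (map_matrix ((*) s) A) $ i $ j = (\<Sum>k<K. s ^ k / fact k * mat_pow A k $ i $ j)"
proof -
  have "mat_pow (map_matrix ((*) s) A) K = 0"
    by (simp add: mat_pow_scale assms vec_eq_iff)
  then show ?thesis
    by (simp add: mat_exp_nilpotent mat_pow_scale)
      (simp add: scaleR_conv_of_real[where 'a = 'a] field_simps)
qed

text \<open>Both factors are polynomials in the same matrix; comparing coefficients of
  \<open>mat_pow A k\<close> leaves the binomial theorem.\<close>

lemma mat_exp_add_scale:
  fixes A :: "'a::real_normed_field^'n^'n"
  assumes K: "mat_pow A K = 0"
  shows "mat_exp (map_matrix ((*) (s + t)) A) =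
    mat_exp (map_matrix ((*) s) A) ** mat_exp (map_matrix ((*) t) A)"
proof -
  have "(mat_exp (map_matrix ((*) s) A) ** mat_exp (map_matrix ((*) t) A)) $ i $ j =
      mat_exp (map_matrix ((*) (s + t)) A) $ i $ j" for i j
  proof -
    let ?g = "\<lambda>a b. s ^ a / fact a * (t ^ b / fact b) * mat_pow A (a + b) $ i $ j"
    have "(mat_exp (map_matrix ((*) s) A) ** mat_exp (map_matrix ((*) t) A)) $ i $ j =
        (\<Sum>l\<in>UNIV. \<Sum>a<K. \<Sum>b<K. s ^ a / fact a * (t ^ b / fact b) * (mat_pow A a $ i $ l * mat_pow A b $ l $ j))"
      by (simp add: matrix_matrix_mult_def mat_exp_scale_nth[OF K] sum_product mult_ac)
    also have "\<dots> = (\<Sum>a<K. \<Sum>b<K. \<Sum>l\<in>UNIV. s ^ a / fact a * (t ^ b / fact b) * (mat_pow A a $ i $ l * mat_pow A b $ l $ j))"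
      by (subst sum.swap) (intro sum.cong refl sum.swap)
    also have "\<dots> = (\<Sum>a<K. \<Sum>b<K. ?g a b)"
      by (simp add: mat_pow_add matrix_matrix_mult_def sum_distrib_left)
    also have "\<dots> = (\<Sum>(a, b)\<in>{..<K} \<times> {..<K}. ?g a b)"
      by (rule sum.cartesian_product)
    \<comment> \<open>Nilpotency kills the terms with \<open>K \<le> a + b\<close>: the square of
      indices shrinks to a triangle, which is then summed along its diagonals.\<close>
    also have "\<dots> = (\<Sum>(a, b)\<in>{(a, b). a + b < K}. ?g a b)"
    proof (rule sum.mono_neutral_right)
      show "{(a, b). a + b < K} \<subseteq> {..<K} \<times> {..<K}" by auto
      show "\<forall>x\<in>{..<K} \<times> {..<K} - {(a, b). a + b < K}. (case x of (a, b) \<Rightarrow> ?g a b) = 0"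
      proof
        fix x
        assume "x \<in> {..<K} \<times> {..<K} - {(a, b). a + b < K}"
        then obtain a b where "x = (a, b)" "K \<le> a + b"
          by (cases x) auto
        then show "(case x of (a, b) \<Rightarrow> ?g a b) = 0"
          by (simp add: mat_pow_eq_0_mono[OF K])
      qed
    qed auto
    also have "\<dots> = (\<Sum>k<K. \<Sum>a\<le>k. ?g a (k - a))"
      by (rule sum.triangle_reindex)
    also have "\<dots> = (\<Sum>k<K. (s + t) ^ k / fact k * mat_pow A k $ i $ j)"
    proof (rule sum.cong[OF refl])
      fix k
      have "(\<Sum>a\<le>k. ?g a (k - a)) =
          (\<Sum>a\<le>k. of_nat (k choose a) * s ^ a * t ^ (k - a)) / fact k * mat_pow A k $ i $ j"
        unfolding sum_divide_distrib sum_distrib_right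
        by (intro sum.cong refl) (simp add: binomial_fact field_simps)
      then show "(\<Sum>a\<le>k. ?g a (k - a)) = (s + t) ^ k / fact k * mat_pow A k $ i $ j"
        by (simp only: binomial_ring)
    qed
    finally show ?thesis
      by (simp add: mat_exp_scale_nth[OF K])
  qed
  then show ?thesis
    by (simp add: vec_eq_iff)
qed

lemma map_matrix_mult_1 [simp]: "map_matrix ((*) (1 :: 'a :: comm_ring_1)) A = A"
  by (simp add: vec_eq_iff)

section \<open>The one-parameter group and its orbits\<close>

lemma one_param_eq: "one_param N z = mat_exp (map_matrix ((*) z) (map_matrix of_real N))"
  by (simp add: one_param_def map_matrix_def)

lemma nilpotent_map_of_real:
  "mat_pow N K = 0 \<Longrightarrow> mat_pow (map_matrix of_real N) K = 0"
  by (simp add: mat_pow_map_of_real vec_eq_iff)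

lemma one_param_add:
  assumes "nilpotent_mat N"
  shows "one_param N (z + w) = one_param N z ** one_param N w"
  using assms mat_exp_add_scale[OF nilpotent_map_of_real]
  by (auto simp: nilpotent_mat_def one_param_eq)

text \<open>The real exponential in the hypothesis and the complex one in \<open>one_param\<close>
  are the same finite sum, entry by entry. Thus \<open>z \<mapsto> z + 1\<close> corresponds to the
  action of \<open>r\<close>.\<close>

lemma one_param_1:
  assumes "nilpotent_mat N" "map_matrix of_int r = mat_exp N"
  shows "one_param N 1 = map_matrix of_int r"
proof -
  obtain K where K: "mat_pow N K = 0"
    using assms(1) by (auto simp: nilpotent_mat_def)
  have "one_param N 1 $ i $ j = of_int (r $ i $ j)" for i j
  proof -
    have "one_param N 1 $ i $ j = of_real (mat_exp (map_matrix ((*) 1) N) $ i $ j)"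
      unfolding one_param_eq mat_exp_scale_nth[OF nilpotent_map_of_real[OF K]] mat_exp_scale_nth[OF K]
      by (simp add: mat_pow_map_of_real)
    also have "\<dots> = of_real (map_matrix of_int r $ i $ j)"
      by (simp add: assms(2))
    finally show ?thesis by simp
  qed
  then show ?thesis by (simp add: vec_eq_iff)
qed

lemma one_param_0:
  assumes "nilpotent_mat N"
  shows "one_param N 0 = mat 1"
proof -
  obtain K where "mat_pow N K = 0"
    using assms by (auto simp: nilpotent_mat_def)
  \<comment> \<open>The bound \<open>Suc K\<close> ensures that the finite sum has a term with index
    0 to split off, even if \<open>K\<close> is 0.\<close>
  then have K: "mat_pow (map_matrix of_real N :: complex^'a^'a) (Suc K) = 0"
    using mat_pow_eq_0_mono[OF nilpotent_map_of_real] by (metis le_SucI order_refl)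
  show ?thesis
    by (simp add: one_param_eq vec_eq_iff mat_exp_scale_nth[OF K] sum.lessThan_Suc_shift
        del: sum.lessThan_Suc)
qed

text \<open>The orbit is a polynomial curve in \<open>z\<close>. The derivative is stated as a
  multiple \<open>t *s v'\<close> so that its complex linearity is visible when the chain rule is
  applied.\<close>

lemma one_param_vec_has_derivative:
  assumes "nilpotent_mat N"
  obtains v' where "((\<lambda>z. one_param N z *v Z) has_derivative (\<lambda>t. t *s v')) (at z0)"
proof -
  obtain K where K: "mat_pow N K = 0"
    using assms by (auto simp: nilpotent_mat_def)
  define u where "u k = mat_pow (map_matrix of_real N) k *v Z" for k
  have eq: "one_param N z *v Z = (\<Sum>k<K. (z ^ k / fact k) *s u k)" for z
    unfolding vec_eq_iff u_def one_param_eq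
    by (auto simp: matrix_vector_mult_def mat_exp_scale_nth[OF nilpotent_map_of_real[OF K]]
        sum_distrib_left sum_distrib_right mult_ac intro: sum.swap)
  have lin: "bounded_linear (\<lambda>t. t *s u k)" for k
    by (rule linear_conv_bounded_linear[THEN iffD1])
      (auto simp: linear_iff vec_eq_iff algebra_simps)
  have "((\<lambda>z. (z ^ k / fact k) *s u k) has_derivative (\<lambda>t. (of_nat k * z0 ^ (k - 1) / fact k * t) *s u k)) (at z0)" for k
  proof -
    have "((\<lambda>z. z ^ k / fact k) has_field_derivative of_nat k * z0 ^ (k - 1) / fact k) (at z0)"
      by (auto intro!: derivative_eq_intros)
    then show ?thesis
      unfolding has_field_derivative_def
      by (rule bounded_linear.has_derivative[OF lin])
  qed
  then have "((\<lambda>z. \<Sum>k<K. (z ^ k / fact k) *s u k) has_derivative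
      (\<lambda>t. \<Sum>k<K. (of_nat k * z0 ^ (k - 1) / fact k * t) *s u k)) (at z0)"
    by (intro has_derivative_sum)
  also have "(\<lambda>t. \<Sum>k<K. (of_nat k * z0 ^ (k - 1) / fact k * t) *s u k) =
      (\<lambda>t. t *s (\<Sum>k<K. (of_nat k * z0 ^ (k - 1) / fact k) *s u k))"
    by (auto simp: vec_eq_iff sum_distrib_left mult_ac)
  finally show thesis
    using that by (simp add: eq)
qed

section \<open>The determinant of an integral unipotent element\<close>

text \<open>\<open>exp N\<close> is the square of the real matrix \<open>exp (N/2)\<close>, so its
  determinant is a real square.\<close>

lemma det_mat_exp_nilpotent_nonneg:
  fixes N :: "real^'n^'n"
  assumes "nilpotent_mat N"
  shows "0 \<le> det (mat_exp N)"
proof -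
  obtain K where K: "mat_pow N K = 0"
    using assms by (auto simp: nilpotent_mat_def)
  have "mat_exp N = mat_exp (map_matrix ((*) (1/2)) N) ** mat_exp (map_matrix ((*) (1/2)) N)"
    using mat_exp_add_scale[OF K, of "1/2" "1/2"] by simp
  then have "det (mat_exp N) = (det (mat_exp (map_matrix ((*) (1/2)) N)))\<^sup>2"
    by (simp add: det_mul power2_eq_square)
  then show ?thesis by simp
qed

lemma det_map_of_int: "det (map_matrix of_int A) = of_int (det A)"
  by (simp add: det_def)

lemma det_int_exp_nilpotent:
  fixes r :: "int^'n^'n" and N :: "real^'n^'n"
  assumes "invertible r" "nilpotent_mat N" "map_matrix of_int r = mat_exp N"
  shows "det r = 1"
proof -
  have "det r dvd 1"
    using assms(1) unfolding invertible_def by (metis det_I det_mul dvd_triv_left)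
  moreover have "0 \<le> real_of_int (det r)"
    using det_mat_exp_nilpotent_nonneg[OF assms(2)] by (simp add: assms(3)[symmetric] det_map_of_int)
  ultimately show ?thesis by (simp add: zdvd1_eq)
qed

text \<open>Invertibility is meant over \<int> here, which is what makes \<open>det r\<close> a
  unit.\<close>

lemma arithmetic_subgroup_invertible:
  assumes "arithmetic_subgroup G \<Gamma>" "r \<in> \<Gamma>"
  shows "invertible r"
proof -
  have "r \<in> carrier (matrix_group (orth_tilde_plus G))"
    using assms subgroup.subset unfolding arithmetic_subgroup_def by blast
  then show ?thesis
    by (simp add: matrix_group_def orth_tilde_plus_def orth_group_def)
qed


section \<open>Expansions along a boundary divisor\<close>

text \<open>The cone is not open in its ambient space, so the chain rule is applied to a local
  ambient extension \<open>h\<close> of \<open>\<psi>\<close>. The composite is holomorphic on a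
  full neighbourhood of \<open>z0\<close>, also when \<open>z0\<close> is real and the orbit may
  leave the cone nearby; agreement with \<open>\<psi>\<close> is claimed only where it does
  not.\<close>

lemma orbit_locally_holomorphic:
  assumes \<psi>: "holomorphic_on_submanifold \<psi> S" and N: "nilpotent_mat N"
    and z0: "one_param N z0 *v Z \<in> S"
  shows "\<exists>W g. open W \<and> z0 \<in> W \<and> g holomorphic_on W \<and>
    (\<forall>z\<in>W. one_param N z *v Z \<in> S \<longrightarrow> g z = \<psi> (one_param N z *v Z))"
proof -
  let ?\<gamma> = "\<lambda>z. one_param N z *v Z"
  have "\<exists>V h. open V \<and> ?\<gamma> z0 \<in> V \<and> (\<forall>Y\<in>V \<inter> S. h Y = \<psi> Y) \<and>
      (\<forall>Y\<in>V. \<exists>a. (h has_derivative (\<lambda>v. \<Sum>i\<in>UNIV. a $ i * v $ i)) (at Y))"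
    using \<psi> z0 unfolding holomorphic_on_submanifold_def by (rule bspec)
  then obtain V h where V: "open V" "?\<gamma> z0 \<in> V" and h: "\<forall>Y\<in>V \<inter> S. h Y = \<psi> Y"
    and diff: "\<forall>Y\<in>V. \<exists>a. (h has_derivative (\<lambda>v. \<Sum>i\<in>UNIV. a $ i * v $ i)) (at Y)"
    by (elim exE conjE) (rule that)
  have "isCont ?\<gamma> z" for z
    using one_param_vec_has_derivative[OF N, of Z z] has_derivative_continuous by blast
  then have "open (?\<gamma> -` V)"
    by (intro continuous_open_vimage V(1))
  moreover have "(h \<circ> ?\<gamma>) holomorphic_on ?\<gamma> -` V"
    unfolding holomorphic_on_open[OF \<open>open (?\<gamma> -` V)\<close>]
  proof
    fix z
    assume "z \<in> ?\<gamma> -` V"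
    then obtain a where a: "(h has_derivative (\<lambda>v. \<Sum>i\<in>UNIV. a $ i * v $ i)) (at (?\<gamma> z))"
      using diff by blast
    obtain v' where v': "(?\<gamma> has_derivative (\<lambda>t. t *s v')) (at z)"
      using one_param_vec_has_derivative[OF N] by blast
    have "((h \<circ> ?\<gamma>) has_derivative (\<lambda>v. \<Sum>i\<in>UNIV. a $ i * v $ i) \<circ> (\<lambda>t. t *s v')) (at z)"
      using v' a by (rule diff_chain_at)
    also have "(\<lambda>v. \<Sum>i\<in>UNIV. a $ i * v $ i) \<circ> (\<lambda>t. t *s v') =
        (*) (\<Sum>i\<in>UNIV. a $ i * v' $ i)"
      by (auto simp: fun_eq_iff sum_distrib_left mult_ac)
    finally show "\<exists>f'. ((h \<circ> ?\<gamma>) has_field_derivative f') (at z)"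
      unfolding has_field_derivative_def by blast
  qed
  ultimately show ?thesis
    using V h by (intro exI[of _ "?\<gamma> -` V"] exI[of _ "h \<circ> ?\<gamma>"]) auto
qed

section \<open>Fourier expansion on the closed upper half-plane\<close>

definition nome :: "complex \<Rightarrow> complex" where
  "nome z = exp (2 * of_real pi * \<i> * z)"

lemma nome_nonzero [simp]: "nome z \<noteq> 0"
  by (simp add: nome_def)

lemma norm_nome: "norm (nome z) = exp (- (2 * pi * Im z))"
  by (simp add: nome_def norm_exp_eq_Re)

lemma norm_nome_le_1_iff: "norm (nome z) \<le> 1 \<longleftrightarrow> 0 \<le> Im z"
  by (simp add: norm_nome zero_le_mult_iff not_le[THEN iffD2, OF pi_gt_zero])

lemma nome_powi: "nome z powi m = exp (2 * of_real pi * \<i> * of_int m * z)"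
  by (simp add: nome_def exp_power_int mult_ac)

lemma nome_eq_iff: "nome z = nome w \<longleftrightarrow> (\<exists>n::int. z = w + of_int n)"
proof -
  have "2 * of_real pi * \<i> * z = 2 * of_real pi * \<i> * w + (of_int (2 * n) * pi) * \<i> \<longleftrightarrow>
      z = w + of_int n" for n :: int
  proof -
    have "2 * of_real pi * \<i> * w + (of_int (2 * n) * pi) * \<i> = 2 * of_real pi * \<i> * (w + of_int n)"
      by (simp add: algebra_simps)
    then show ?thesis
      by (simp only: mult_cancel_left) simp
  qed
  then show ?thesis
    by (simp add: nome_def exp_eq)
qed

lemma nome_Ln: "p \<noteq> 0 \<Longrightarrow> nome (Ln p / (2 * of_real pi * \<i>)) = p"
  by (simp add: nome_def)

text \<open>By periodicity \<open>f\<close> descends to the punctured closed unit disc. The series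
  has to converge for real \<open>z\<close> too, that is on the unit circle itself, which is why the
  descended function is first extended beyond the circle and then expanded.\<close>

theorem Fourier_expansion_upper_half_plane:
  fixes f :: "complex \<Rightarrow> complex"
  assumes per: "\<And>z. 0 \<le> Im z \<Longrightarrow> f (z + 1) = f z"
    and loc: "\<And>z0. 0 \<le> Im z0 \<Longrightarrow> \<exists>W g. open W \<and> z0 \<in> W \<and> g holomorphic_on W \<and>
      (\<forall>z\<in>W. 0 \<le> Im z \<longrightarrow> g z = f z)"
  shows "\<exists>b :: int \<Rightarrow> complex. \<forall>z. 0 \<le> Im z \<longrightarrow>
    ((\<lambda>m. b m * exp (2 * of_real pi * \<i> * of_int m * z)) has_sum f z) UNIV"
proof -
  have per_nat: "f (z + of_nat n) = f z" if "0 \<le> Im z" for z n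
    using that per[of "z + of_nat _"] by (induction n) (auto simp: add_ac)
  have per_int: "f (z + of_int n) = f z" if "0 \<le> Im z" for z n
  proof (cases "0 \<le> n")
    case True
    then show ?thesis
      using per_nat[OF that, of "nat n"] by simp
  next
    case False
    then show ?thesis
      using per_nat[of "z + of_int n" "nat (- n)"] that by simp
  qed
  have f_eq: "f z = f w" if "nome z = nome w" "0 \<le> Im w" for z w
    using that per_int by (auto simp: nome_eq_iff)
  \<comment> \<open>The cut of \<open>Ln\<close> does no harm: by \<open>f_eq\<close> the value is
    the same for every logarithm of \<open>q\<close> when \<open>norm q\<close> is at most
    1.\<close>
  define F where "F q = f (Ln q / (2 * of_real pi * \<i>))" for q
  have F: "F (nome z) = f z" if "0 \<le> Im z" for z
    unfolding F_def by (rule f_eq) (simp_all add: nome_Ln that)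
  have "\<exists>W g. open W \<and> p \<in> W \<and> g holomorphic_on W \<and> (\<forall>q\<in>W. norm q \<le> 1 \<longrightarrow> g q = F q)"
    if p: "p \<noteq> 0" "norm p \<le> 1" for p
  proof -
    define z0 where "z0 = Ln p / (2 * of_real pi * \<i>)"
    have z0: "nome z0 = p"
      by (simp add: z0_def nome_Ln p)
    with p have "0 \<le> Im z0"
      by (simp flip: norm_nome_le_1_iff)
    from loc[OF this] obtain W g where W: "open W" "z0 \<in> W" and g: "g holomorphic_on W"
      and gf: "\<And>z. z \<in> W \<Longrightarrow> 0 \<le> Im z \<Longrightarrow> g z = f z"
      by metis
    \<comment> \<open>A local inverse of \<open>nome\<close> with value \<open>z0\<close> at
      \<open>p\<close>. Dividing by \<open>p\<close> turns the cut of \<open>Ln\<close> away, so the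
      branch is holomorphic on the half-plane \<open>0 < Re (q / p)\<close> around
      \<open>p\<close>.\<close>
    define branch where "branch q = z0 + Ln (q / p) / (2 * of_real pi * \<i>)" for q
    have nome_branch: "nome (branch q) = q" if "q \<noteq> 0" for q
    proof -
      have "nome (branch q) = nome z0 * nome (Ln (q / p) / (2 * of_real pi * \<i>))"
        unfolding nome_def branch_def by (simp only: distrib_left exp_add)
      also have "\<dots> = q"
        using that p by (subst nome_Ln) (auto simp: z0)
      finally show ?thesis .
    qed
    have U: "open {q. 0 < Re (q / p)}"
      by (intro open_Collect_less continuous_intros) (use p in auto)
    have branch: "branch holomorphic_on {q. 0 < Re (q / p)}"
      unfolding branch_def by (intro holomorphic_intros) (use p in \<open>auto simp: complex_nonpos_Reals_iff\<close>)
    define V where "V = {q. 0 < Re (q / p)} \<inter> branch -` W"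
    have "open V"
      unfolding V_def by (intro continuous_open_preimage holomorphic_on_imp_continuous_on branch U W)
    moreover have "p \<in> V"
      using p W by (simp add: V_def branch_def)
    moreover have "g \<circ> branch holomorphic_on V"
      by (rule holomorphic_on_compose_gen[OF holomorphic_on_subset[OF branch] g]) (auto simp: V_def)
    moreover have "(g \<circ> branch) q = F q" if q: "q \<in> V" "norm q \<le> 1" for q
    proof -
      have "q \<noteq> 0"
        using q by (auto simp: V_def)
      then have *: "nome (branch q) = q"
        by (rule nome_branch)
      then have "0 \<le> Im (branch q)"
        using q by (simp flip: norm_nome_le_1_iff)
      then show ?thesis
        using F[of "branch q"] gf[of "branch q"] q * by (simp add: V_def)
    qed
    ultimately show ?thesis by blast
  qed
  then obtain R H where R: "1 < R" and H: "H holomorphic_on ball 0 R - {0}"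
    and HF: "\<And>q. q \<noteq> 0 \<Longrightarrow> norm q \<le> 1 \<Longrightarrow> H q = F q"
    using holomorphic_extension_across_unit_circle[of F] by blast
  define b where "b m = residue (\<lambda>w. H w * w powi (- m - 1)) 0" for m
  have "((\<lambda>m. b m * exp (2 * of_real pi * \<i> * of_int m * z)) has_sum f z) UNIV" if "0 \<le> Im z" for z
  proof -
    have "norm (nome z) \<le> 1"
      using that by (simp add: norm_nome_le_1_iff)
    then have "((\<lambda>m. b m * nome z powi m) has_sum H (nome z)) UNIV"
      unfolding b_def using R by (intro Laurent_series_punctured_ball[OF H]) auto
    then show ?thesis
      using HF[of "nome z"] \<open>norm (nome z) \<le> 1\<close> F[OF that] by (simp add: nome_powi)
  qed
  then show ?thesis by blast
qed

text \<open>Real values of \<open>z\<close> already suffice: \<open>nome\<close> maps them onto the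
  unit circle, where the difference of the two series sums to 0.\<close>

lemma Fourier_coeffs_unique:
  fixes b b' :: "int \<Rightarrow> complex"
  assumes "\<And>z. 0 \<le> Im z \<Longrightarrow> ((\<lambda>m. b m * exp (2 * of_real pi * \<i> * of_int m * z)) has_sum f z) UNIV"
    and "\<And>z. 0 \<le> Im z \<Longrightarrow> ((\<lambda>m. b' m * exp (2 * of_real pi * \<i> * of_int m * z)) has_sum f z) UNIV"
  shows "b = b'"
proof
  fix m
  have "b m - b' m = 0"
  proof (rule Laurent_coeffs_unique)
    fix q :: complex
    assume q: "norm q = 1"
    define z where "z = Ln q / (2 * of_real pi * \<i>)"
    have "q \<noteq> 0"
      using q by auto
    then have z: "nome z = q"
      by (simp add: z_def nome_Ln)
    with q have "0 \<le> Im z"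
      by (simp flip: norm_nome_le_1_iff)
    then have "((\<lambda>m. b m * q powi m + - (b' m * q powi m)) has_sum f z + - f z) UNIV"
      using assms by (intro has_sum_add has_sum_uminusI) (simp_all flip: z add: nome_powi)
    then show "((\<lambda>m. (b m - b' m) * q powi m) has_sum 0) UNIV"
      by (simp add: algebra_simps)
  qed
  then show "b m = b' m" by simp
qed

section \<open>Existence and uniqueness of the expansion of a modular form\<close>

text \<open>This turns a trivial character value at \<open>r\<close> into integrality of the shift
  \<open>a\<close>, hence of all exponents.\<close>

lemma exp_2pi_i_rat_eq_1_iff:
  "exp (2 * of_real pi * \<i> * of_rat a) = (1 :: complex) \<longleftrightarrow> a \<in> \<int>"
proof -
  have "exp (2 * of_real pi * \<i> * of_rat a) = (1 :: complex) \<longleftrightarrow> nome (of_rat a) = nome 0"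
    by (simp add: nome_def)
  also have "\<dots> \<longleftrightarrow> (\<exists>n::int. (of_rat a :: complex) = of_rat (of_int n))"
    by (simp add: nome_eq_iff)
  also have "\<dots> \<longleftrightarrow> a \<in> \<int>"
    unfolding of_rat_eq_iff by (auto elim: Ints_cases)
  finally show ?thesis .
qed

lemma diff_Ints_iff: "(a :: 'a :: ring_1) \<in> \<int> \<Longrightarrow> m - a \<in> \<int> \<longleftrightarrow> m \<in> \<int>"
  by (metis Ints_add Ints_diff diff_add_cancel)

text \<open>For integral \<open>a\<close> the coset \<open>a + \<int>\<close> is \<int>, so the
  rational indices can be traded for integers and \<open>a\<close> disappears.\<close>

lemma expansion_iff:
  assumes "a \<in> \<int>"
  shows "expansion D \<psi> N a c \<longleftrightarrow>
    (\<forall>z. Im z \<ge> 0 \<longrightarrow> (\<forall>Z\<in>affine_cone D.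
      ((\<lambda>m::int. c (of_int m) Z * exp (2 * of_real pi * \<i> * of_int m * z)) has_sum
        \<psi> (one_param N z *v Z)) UNIV))"
proof -
  have "{m. m - a \<in> \<int>} = range of_int"
    by (simp only: diff_Ints_iff[OF assms] Collect_mem_eq) (simp only: Ints_def)
  then show ?thesis
    unfolding expansion_def
    by (simp add: has_sum_reindex inj_on_def o_def)
qed

text \<open>The order of vanishing is defined through some choice of \<open>a\<close> and
  \<open>c\<close>; this makes it independent of the choice. Values of \<open>c\<close> at
  non-integral indices do not enter the expansion, whence the restriction on
  \<open>m\<close>.\<close>

lemma expansion_unique:
  assumes "a \<in> \<int>" "a' \<in> \<int>" "expansion D \<psi> N a c" "expansion D \<psi> N a' c'"
    and "m \<in> \<int>" "Z \<in> affine_cone D"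
  shows "c m Z = c' m Z"
proof -
  have "(\<lambda>m::int. c (of_int m) Z) = (\<lambda>m. c' (of_int m) Z)"
    by (rule Fourier_coeffs_unique[where f = "\<lambda>z. \<psi> (one_param N z *v Z)"])
      (use assms in \<open>simp_all add: expansion_iff\<close>)
  then show ?thesis
    using \<open>m \<in> \<int>\<close> by (auto elim!: Ints_cases dest: fun_cong)
qed

text \<open>For each fixed \<open>Z\<close>, invariance under \<open>r\<close> is periodicity in
  \<open>z\<close>, and the Fourier expansion applies. The coefficients are obtained point by point
  in \<open>Z\<close>; their regularity in \<open>Z\<close> is not part of
  \<open>expansion\<close>.\<close>

lemma ex_expansion:
  assumes \<psi>: "modular_form G D \<Gamma> k \<eta> \<psi>" and div: "boundary_divisor G D \<Gamma> E r N" and "\<eta> r = 1"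
  shows "\<exists>c. expansion D \<psi> N 0 c"
proof -
  have r: "r \<in> \<Gamma>" and N: "nilpotent_mat N" and exp: "map_matrix of_int r = mat_exp N"
    and cone: "\<And>z Z. 0 \<le> Im z \<Longrightarrow> Z \<in> affine_cone D \<Longrightarrow> one_param N z *v Z \<in> affine_cone D"
    using div by (auto simp: boundary_divisor_def cusp_U_int_def)
  have "\<exists>b :: int \<Rightarrow> complex. \<forall>z. 0 \<le> Im z \<longrightarrow>
      ((\<lambda>m. b m * exp (2 * of_real pi * \<i> * of_int m * z)) has_sum \<psi> (one_param N z *v Z)) UNIV"
    if Z: "Z \<in> affine_cone D" for Z
  proof (rule Fourier_expansion_upper_half_plane)
    fix z :: complex
    assume z: "0 \<le> Im z"
    \<comment> \<open>The factor \<open>exp N\<close> is split off on the left, so that the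
      transformation law for \<open>r\<close> is applied at a point of the orbit inside the
      cone.\<close>
    have "one_param N (z + 1) *v Z = map_matrix of_int r *v (one_param N z *v Z)"
      by (simp add: one_param_add[OF N, of 1 z] add.commute[of z] one_param_1[OF N exp]
          matrix_vector_mul_assoc)
    then show "\<psi> (one_param N (z + 1) *v Z) = \<psi> (one_param N z *v Z)"
      using \<psi> r cone[OF z Z] \<open>\<eta> r = 1\<close> by (simp add: modular_form_def)
    have "holomorphic_on_submanifold \<psi> (affine_cone D)"
      using \<psi> by (simp add: modular_form_def)
    from orbit_locally_holomorphic[OF this N cone[OF z Z]]
    show "\<exists>W g. open W \<and> z \<in> W \<and> g holomorphic_on W \<and>
        (\<forall>w\<in>W. 0 \<le> Im w \<longrightarrow> g w = \<psi> (one_param N w *v Z))"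
      using cone[OF _ Z] by blast
  qed
  then obtain b :: "complex^'a \<Rightarrow> int \<Rightarrow> complex"
    where b: "\<And>Z z. Z \<in> affine_cone D \<Longrightarrow> 0 \<le> Im z \<Longrightarrow>
      ((\<lambda>m. b Z m * exp (2 * of_real pi * \<i> * of_int m * z)) has_sum \<psi> (one_param N z *v Z)) UNIV"
    by metis
  \<comment> \<open>The floor only converts the index type from integers to rationals; integral
    indices are the only ones summed over.\<close>
  then have "expansion D \<psi> N 0 (\<lambda>m Z. b Z \<lfloor>m\<rfloor>)"
    by (simp add: expansion_iff)
  then show ?thesis by blast
qed

section \<open>Existence, uniqueness and integrality of the vanishing order\<close>

theorem proposition2p1:
  fixes G :: "int^'n^'n"
    and n :: nat
    and D :: "(complex^'n) set set"
    and \<Gamma> :: "(int^'n^'n) set"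
    and k :: int
    and \<eta> :: "int^'n^'n \<Rightarrow> complex"
    and \<psi> :: "complex^'n \<Rightarrow> complex"
    and E :: "(rat^'n) set"
  assumes "even_lattice G"
    and "has_signature G 2 n"
    and "splits_two_hyperbolic_planes G"
    and "is_domain G D"
    and "arithmetic_subgroup G \<Gamma>"
    and "(\<forall>g\<in>\<Gamma>. \<eta> g = of_int (det g)) \<or> (\<forall>g\<in>\<Gamma>. \<eta> g = 1)"
    and "modular_form G D \<Gamma> k \<eta> \<psi>"
    and "\<exists>Z\<in>affine_cone D. \<psi> Z \<noteq> 0"
    and "is_cusp G E"
  shows "\<forall>r N. boundary_divisor G D \<Gamma> E r N \<longrightarrow>
           (\<exists>m. (\<forall>m'. has_vanishing_order D \<eta> \<psi> r N m' \<longleftrightarrow> m' = m) \<and> m \<in> \<int>)"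
proof (intro allI impI)
  fix r N
  assume div: "boundary_divisor G D \<Gamma> E r N"
  then have r: "r \<in> \<Gamma>" and N: "nilpotent_mat N" and exp: "map_matrix of_int r = mat_exp N"
    by (auto simp: boundary_divisor_def cusp_U_int_def)
  have "det r = 1"
    using arithmetic_subgroup_invertible[OF assms(5) r] N exp by (rule det_int_exp_nilpotent)
  then have \<eta>: "\<eta> r = 1"
    using assms(6) r by auto
  then have Ints: "a \<in> \<int>" if "\<eta> r = exp (2 * of_real pi * \<i> * of_rat a)" for a
    using that exp_2pi_i_rat_eq_1_iff by metis
  obtain c where c: "expansion D \<psi> N 0 c"
    using ex_expansion[OF assms(7) div \<eta>] by blast
  \<comment> \<open>Holomorphy at the cusps speaks about every expansion with an admissible shift;
    it is used for \<open>c\<close> with shift 0, admissible because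
    \<open>\<eta> r = 1\<close>.\<close>
  have c_neg: "c m Z = 0" if "m \<in> \<int>" "m < 0" "Z \<in> affine_cone D" for m Z
  proof -
    have "holomorphic_at_cusps G D \<Gamma> \<eta> \<psi>"
      using assms(7) by (simp add: modular_form_def)
    moreover have "\<eta> r = exp (2 * of_real pi * \<i> * of_rat 0)"
      using \<eta> by simp
    ultimately have "\<forall>m. m - 0 \<in> \<int> \<longrightarrow> m < 0 \<longrightarrow> (\<forall>Z\<in>affine_cone D. c m Z = 0)"
      using assms(9) div c unfolding holomorphic_at_cusps_def by metis
    then show ?thesis
      using that by simp
  qed
  \<comment> \<open>Negative coefficients vanish, so the search for the lowest index runs over the
    naturals and \<open>LEAST\<close> applies.\<close>
  define P where "P j \<longleftrightarrow> (\<exists>Z\<in>affine_cone D. c (of_nat j) Z \<noteq> 0)" for j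
  have "\<exists>j. P j"
  proof (rule ccontr)
    assume "\<nexists>j. P j"
    then have zero: "c (of_int m) Z = 0" if "Z \<in> affine_cone D" for m Z
    proof (cases "m < 0")
      case True
      then show ?thesis
        using that by (intro c_neg) auto
    next
      case False
      then have "of_int m = (of_nat (nat m) :: rat)"
        by simp
      then show ?thesis
        using \<open>\<nexists>j. P j\<close> that unfolding P_def by metis
    qed
    obtain Z where Z: "Z \<in> affine_cone D" "\<psi> Z \<noteq> 0"
      using assms(8) by blast
    \<comment> \<open>At \<open>z = 0\<close> the expansion computes \<open>\<psi> Z\<close> itself,
      so vanishing of all coefficients contradicts the choice of \<open>Z\<close>.\<close>
    have "((\<lambda>m::int. c (of_int m) Z * exp (2 * of_real pi * \<i> * of_int m * 0)) has_sum
        \<psi> (one_param N 0 *v Z)) UNIV"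
      by (rule c[unfolded expansion_iff[OF Ints_0], rule_format]) (simp_all add: Z)
    then have "((\<lambda>m::int. 0) has_sum \<psi> Z) UNIV"
      by (simp add: zero[OF Z(1)] one_param_0[OF N])
    then have "\<psi> Z = 0"
      by (rule has_sum_unique) (simp add: has_sum_0)
    then show False
      using Z(2) by simp
  qed
  define m :: rat where "m = of_nat (LEAST j. P j)"
  have m_Ints: "m \<in> \<int>"
    by (simp add: m_def)
  have m_nonzero: "\<exists>Z\<in>affine_cone D. c m Z \<noteq> 0"
    using LeastI_ex[OF \<open>\<exists>j. P j\<close>] by (simp add: P_def m_def)
  have m_least: "c m' Z = 0" if "m' \<in> \<int>" "m' < m" "Z \<in> affine_cone D" for m' Z
  proof (cases "m' < 0")
    case True
    then show ?thesis
      using c_neg that by blast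
  next
    case False
    obtain i where "m' = of_int i"
      using \<open>m' \<in> \<int>\<close> by (rule Ints_cases)
    with False have j: "m' = of_nat (nat i)"
      by simp
    with \<open>m' < m\<close> have "nat i < (LEAST j. P j)"
      unfolding m_def by (simp only: of_nat_less_iff)
    then have "\<not> P (nat i)"
      by (rule not_less_Least)
    then show ?thesis
      using that(3) by (simp only: P_def j) blast
  qed
  have "has_vanishing_order D \<eta> \<psi> r N m' \<longleftrightarrow> m' = m" for m'
  proof
    assume "m' = m"
    then show "has_vanishing_order D \<eta> \<psi> r N m'"
      unfolding has_vanishing_order_def using \<eta> c m_Ints m_nonzero m_least
      by (intro exI[of _ 0] exI[of _ c]) auto
  next
    assume "has_vanishing_order D \<eta> \<psi> r N m'"
    then obtain a c' where a: "a \<in> \<int>" and c': "expansion D \<psi> N a c'" and m': "m' - a \<in> \<int>"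
      and nonzero: "\<exists>Z\<in>affine_cone D. c' m' Z \<noteq> 0"
      and least: "\<And>l Z. l - a \<in> \<int> \<Longrightarrow> l < m' \<Longrightarrow> Z \<in> affine_cone D \<Longrightarrow> c' l Z = 0"
      unfolding has_vanishing_order_def using Ints by blast
    \<comment> \<open>An arbitrary witness of \<open>has_vanishing_order\<close> is compared with
      \<open>c\<close>; once the coefficients agree, minimality on either side excludes both strict
      inequalities.\<close>
    have eq: "c' l Z = c l Z" if "l \<in> \<int>" "Z \<in> affine_cone D" for l Z
      using expansion_unique[OF a _ c' c] that by simp
    have "m' \<in> \<int>"
      using m' a by (simp add: diff_Ints_iff)
    then have "\<not> m' < m"
      using nonzero m_least eq by metis
    moreover have "\<not> m < m'"
      using m_nonzero least[of m] eq m_Ints a by (auto simp: diff_Ints_iff)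
    ultimately show "m' = m" by simp
  qed
  then show "\<exists>m. (\<forall>m'. has_vanishing_order D \<eta> \<psi> r N m' \<longleftrightarrow> m' = m) \<and> m \<in> \<int>"
    using m_Ints by blast
qed

end
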